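(* The satisfiability problem is undecidable for the class of formulas $\Phi_1 \wedge \Phi_2$, where $\Phi_1$ is a prenex formula of linear integer arithmetic with quantifier prefix in $\exists^*\forall^*$ and $\Phi_2$ is a prenex formula of linear integer arithmetic with quantifier prefix in $\forall^*\exists^*$, both over the signature of linear integer arithmetic extended with a single monadic predicate symbol $P$, where $P$ is required to be interpreted as a finite set of integers.
   Context: Linear integer arithmetic ($\mathsf{LIA}$) has the sort $\mathsf{Int}$ interpreted as the integers, the predicate $\geq$, addition $+$, and constants $0,1$, with their standard interpretation, and no uninterpreted function symbols. Formulas may have free variables (interpreted as integers); a formula is satisfiable if some assignment of integers to its free variables and some finite set of integers interpreting $P$ make it true. *)

theory Defs
  imports Main "HOL-Library.Nat_Bijection"
begin

datatype tm = Var nat | Zero | One | Add tm tm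

datatype fm =
    Ge tm tm
  | PAt tm
  | Neg fm
  | Conj fm fm
  | Disj fm fm
  | Ex nat fm
  | All nat fm

fun tval :: "(nat \<Rightarrow> int) \<Rightarrow> tm \<Rightarrow> int" where
  "tval v (Var n) = v n"
| "tval v Zero = 0"
| "tval v One = 1"
| "tval v (Add s t) = tval v s + tval v t"

fun holds :: "(nat \<Rightarrow> int) \<Rightarrow> int set \<Rightarrow> fm \<Rightarrow> bool" where
  "holds v P (Ge s t) = (tval v s \<ge> tval v t)"
| "holds v P (PAt t) = (tval v t \<in> P)"
| "holds v P (Neg f) = (\<not> holds v P f)"
| "holds v P (Conj f g) = (holds v P f \<and> holds v P g)"
| "holds v P (Disj f g) = (holds v P f \<or> holds v P g)"
| "holds v P (Ex x f) = (\<exists>i::int. holds (v(x := i)) P f)"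
| "holds v P (All x f) = (\<forall>i::int. holds (v(x := i)) P f)"

definition satisfiable :: "fm \<Rightarrow> bool" where
  "satisfiable f \<longleftrightarrow> (\<exists>v P. finite P \<and> holds v P f)"

fun qfree :: "fm \<Rightarrow> bool" where
  "qfree (Ge s t) = True"
| "qfree (PAt t) = True"
| "qfree (Neg f) = qfree f"
| "qfree (Conj f g) = (qfree f \<and> qfree g)"
| "qfree (Disj f g) = (qfree f \<and> qfree g)"
| "qfree (Ex x f) = False"
| "qfree (All x f) = False"

definition exs :: "nat list \<Rightarrow> fm \<Rightarrow> fm" where
  "exs xs f = foldr Ex xs f"

definition alls :: "nat list \<Rightarrow> fm \<Rightarrow> fm" where
  "alls xs f = foldr All xs f"

definition EA_prenex :: "fm set" where
  "EA_prenex = {exs xs (alls ys g) | xs ys g. qfree g}"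

definition AE_prenex :: "fm set" where
  "AE_prenex = {alls xs (exs ys g) | xs ys g. qfree g}"

definition EA_AE_class :: "fm set" where
  "EA_AE_class = {Conj f1 f2 | f1 f2. f1 \<in> EA_prenex \<and> f2 \<in> AE_prenex}"

fun enc_tm :: "tm \<Rightarrow> nat" where
  "enc_tm (Var n) = prod_encode (0, n)"
| "enc_tm Zero = prod_encode (1, 0)"
| "enc_tm One = prod_encode (2, 0)"
| "enc_tm (Add s t) = prod_encode (3, prod_encode (enc_tm s, enc_tm t))"

fun enc_fm :: "fm \<Rightarrow> nat" where
  "enc_fm (Ge s t) = prod_encode (0, prod_encode (enc_tm s, enc_tm t))"
| "enc_fm (PAt t) = prod_encode (1, enc_tm t)"
| "enc_fm (Neg f) = prod_encode (2, enc_fm f)"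
| "enc_fm (Conj f g) = prod_encode (3, prod_encode (enc_fm f, enc_fm g))"
| "enc_fm (Disj f g) = prod_encode (4, prod_encode (enc_fm f, enc_fm g))"
| "enc_fm (Ex x f) = prod_encode (5, prod_encode (x, enc_fm f))"
| "enc_fm (All x f) = prod_encode (6, prod_encode (x, enc_fm f))"

datatype recf =
    Z
  | Sc
  | Pr nat
  | Cn recf "recf list"
  | PrimRec recf recf
  | Mn recf

inductive recf_eval :: "recf \<Rightarrow> nat list \<Rightarrow> nat \<Rightarrow> bool" where
  ev_Z: "recf_eval Z xs 0"
| ev_Sc: "recf_eval Sc (x # xs) (Suc x)"
| ev_Pr: "i < length xs \<Longrightarrow> recf_eval (Pr i) xs (xs ! i)"
| ev_Cn: "list_all2 (\<lambda>g y. recf_eval g xs y) gs ys \<Longrightarrow> recf_eval f ys z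
          \<Longrightarrow> recf_eval (Cn f gs) xs z"
| ev_Prim0: "recf_eval f xs y \<Longrightarrow> recf_eval (PrimRec f g) (0 # xs) y"
| ev_PrimS: "recf_eval (PrimRec f g) (n # xs) y \<Longrightarrow> recf_eval g (n # y # xs) z
          \<Longrightarrow> recf_eval (PrimRec f g) (Suc n # xs) z"
| ev_Mn: "recf_eval f (n # xs) 0 \<Longrightarrow> (\<forall>m<n. \<exists>k. recf_eval f (m # xs) (Suc k))
          \<Longrightarrow> recf_eval (Mn f) xs n"

definition sat_decidable :: "fm set \<Rightarrow> bool" where
  "sat_decidable C \<longleftrightarrow>
     (\<exists>f. \<forall>\<phi>\<in>C. recf_eval f [enc_fm \<phi>] (if satisfiable \<phi> then 1 else 0))"

end

theory Submission
  imports Defs "HOL-Library.Countable"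
begin

text \<open>Evaluations of a recursive function \<open>h\<close> are derivations in a finite Horn program over facts
  \<open>(tag, y, xs)\<close>. A derivation is a finite sequence of facts, each justified by earlier
  ones, and can be laid out in a finite set of integers as records at increasing positions. That every
  record is justified by records at smaller positions is a \<open>\<forall>\<^sup>*\<exists>\<^sup>*\<close> condition with linear
  constraints; since \<open>P\<close> is finite, positions are well-founded and every recorded fact is derivable.
  So for each \<open>h\<close> there is a \<open>\<forall>\<^sup>*\<exists>\<^sup>*\<close> formula \<open>\<theta>\<close> with a free variable \<open>x\<^sub>0\<close> such that
  \<open>x\<^sub>0 = n \<and> \<theta>\<close> is satisfiable iff \<open>h(n) = 0\<close>. No universal function is needed: given a
  decision procedure \<open>f\<close>, let \<open>h(n) = f(\<ulcorner>x\<^sub>0 = n \<and> \<psi>\<urcorner>)\<close> for the formula \<open>\<psi>\<close> with code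
  \<open>n\<close>; instantiating the formula of \<open>h\<close> with its own code gives the contradiction.\<close>

section \<open>Recursive functions\<close>

text \<open>Evaluation is only a relation, and the final diagonal contradiction needs that it cannot
  return both 0 and 1.\<close>

lemma recf_eval_deterministic:
  assumes "recf_eval e xs y" "recf_eval e xs z"
  shows "y = z"
  using assms
proof (induction arbitrary: z rule: recf_eval.induct)
  case (ev_Z xs)
  then show ?case by cases auto
next
  case (ev_Sc x xs)
  then show ?case by cases auto
next
  case (ev_Pr i xs)
  from ev_Pr(2) show ?case by cases auto
next
  case (ev_Cn xs gs ys f w)
  from ev_Cn.prems obtain zs where zs: "list_all2 (\<lambda>g y. recf_eval g xs y) gs zs" "recf_eval f zs z"
    by cases auto
  have "ys = zs"
    using zs(1) ev_Cn.IH
    by (intro nth_equalityI) (auto simp: list_all2_conv_all_nth)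
  with zs(2) ev_Cn.IH show ?case by blast
next
  case (ev_Prim0 f xs y g)
  from ev_Prim0(3) show ?case by cases (use ev_Prim0 in auto)
next
  case (ev_PrimS f g n xs y w)
  from ev_PrimS.prems show ?case by cases (use ev_PrimS.IH in blast)
next
  case (ev_Mn f n xs)
  from ev_Mn.prems have z: "recf_eval f (z # xs) 0" "\<forall>m<z. \<exists>k. recf_eval f (m # xs) (Suc k)"
    by (cases, auto)+
  \<comment> \<open>If the two minima differed, the program would return both 0 and a successor at
    the smaller one.\<close>
  have "\<not> z < n" using z(1) ev_Mn.IH by (metis nat.distinct(1))
  moreover have "\<not> n < z" using z(2) ev_Mn.IH by (metis nat.distinct(1))
  ultimately show ?case by simp
qed

text \<open>Lists of any other length are unconstrained, so \<open>F\<close> can be an arbitrary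
  expression in the entries \<open>xs ! i\<close>. The closure properties below go just far enough
  to compute codes of formulas.\<close>

definition computable :: "nat \<Rightarrow> (nat list \<Rightarrow> nat) \<Rightarrow> bool" where
  "computable k F \<longleftrightarrow> (\<exists>r. \<forall>xs. length xs = k \<longrightarrow> recf_eval r xs (F xs))"

lemma computable_proj: "i < k \<Longrightarrow> computable k (\<lambda>xs. xs ! i)"
  unfolding computable_def by (auto intro: recf_eval.intros exI[of _ "Pr i"])

lemma computable_comp1:
  assumes "computable 1 H" "computable k F"
  shows "computable k (\<lambda>xs. H [F xs])"
proof -
  obtain h f where "\<And>xs. length xs = 1 \<Longrightarrow> recf_eval h xs (H xs)"
    "\<And>xs. length xs = k \<Longrightarrow> recf_eval f xs (F xs)"
    using assms unfolding computable_def by blast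
  then show ?thesis
    unfolding computable_def by (intro exI[of _ "Cn h [f]"]) (auto intro!: ev_Cn)
qed

lemma computable_comp2:
  assumes "computable 2 H" "computable k F" "computable k G"
  shows "computable k (\<lambda>xs. H [F xs, G xs])"
proof -
  obtain h f g where "\<And>xs. length xs = 2 \<Longrightarrow> recf_eval h xs (H xs)"
    "\<And>xs. length xs = k \<Longrightarrow> recf_eval f xs (F xs)" "\<And>xs. length xs = k \<Longrightarrow> recf_eval g xs (G xs)"
    using assms unfolding computable_def by blast
  then show ?thesis
    unfolding computable_def
    by (intro exI[of _ "Cn h [f, g]"]) (auto intro!: ev_Cn[where ys = "[F xs, G xs]" for xs])
qed

lemma computable_Suc:
  assumes "computable k F"
  shows "computable k (\<lambda>xs. Suc (F xs))"
proof -
  have "computable 1 (\<lambda>xs. Suc (hd xs))"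
    unfolding computable_def by (intro exI[of _ Sc]) (auto simp: length_Suc_conv intro: ev_Sc)
  from computable_comp1[OF this assms] show ?thesis by simp
qed

lemma computable_const: "computable k (\<lambda>_. c)"
proof (induction c)
  case 0
  show ?case unfolding computable_def by (intro exI[of _ Z]) (auto intro: ev_Z)
next
  case (Suc c)
  then show ?case by (rule computable_Suc)
qed

lemma computable_prim_rec:
  assumes "computable k F" "computable (Suc (Suc k)) G"
    and "\<And>xs. length xs = k \<Longrightarrow> H (0 # xs) = F xs"
    and "\<And>n xs. length xs = k \<Longrightarrow> H (Suc n # xs) = G (n # H (n # xs) # xs)"
  shows "computable (Suc k) H"
proof -
  obtain f g where f: "\<And>xs. length xs = k \<Longrightarrow> recf_eval f xs (F xs)"
    and g: "\<And>xs. length xs = Suc (Suc k) \<Longrightarrow> recf_eval g xs (G xs)"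
    using assms unfolding computable_def by blast
  have "recf_eval (PrimRec f g) (n # xs) (H (n # xs))" if "length xs = k" for n xs
  proof (induction n)
    case 0
    then show ?case using that f assms(3) by (auto intro: ev_Prim0)
  next
    case (Suc n)
    have "recf_eval g (n # H (n # xs) # xs) (H (Suc n # xs))" using that g assms(4) by simp
    with Suc show ?case by (rule ev_PrimS)
  qed
  then show ?thesis
    unfolding computable_def by (intro exI[of _ "PrimRec f g"]) (auto simp: length_Suc_conv)
qed

lemma computable_add:
  assumes "computable k F" "computable k G"
  shows "computable k (\<lambda>xs. F xs + G xs)"
proof -
  have "computable (Suc 1) (\<lambda>xs. xs ! 0 + xs ! 1)"
    by (rule computable_prim_rec[of 1 "\<lambda>xs. xs ! 0" "\<lambda>xs. Suc (xs ! 1)"])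
      (auto intro!: computable_proj computable_Suc)
  from computable_comp2[OF _ assms, of "\<lambda>xs. xs ! 0 + xs ! 1"] this show ?thesis
    by (simp add: numeral_2_eq_2)
qed

text \<open>The pairing of a and b is \<open>triangle (a + b) + a\<close>, and
  \<open>triangle\<close> is primitive recursive by adding \<open>Suc n\<close> at each
  step.\<close>

lemma computable_prod_encode:
  assumes "computable k F" "computable k G"
  shows "computable k (\<lambda>xs. prod_encode (F xs, G xs))"
proof -
  have "computable (Suc 0) (\<lambda>xs. triangle (xs ! 0))"
    by (rule computable_prim_rec[of 0 "\<lambda>_. 0" "\<lambda>xs. Suc (xs ! 0) + xs ! 1"])
      (auto intro!: computable_proj computable_Suc computable_const computable_add simp del: add_Suc)
  then have t: "computable 1 (\<lambda>xs. triangle (xs ! 0))" by simp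
  show ?thesis
    using computable_add[OF computable_comp1[OF t computable_add[OF assms]] assms(1)]
    by (simp add: prod_encode_def)
qed

section \<open>Terms and formulas\<close>

fun num :: "nat \<Rightarrow> tm" where
  "num 0 = Zero"
| "num (Suc n) = Add (num n) One"

fun tmul :: "nat \<Rightarrow> tm \<Rightarrow> tm" where
  "tmul 0 t = Zero"
| "tmul (Suc n) t = Add (tmul n t) t"

fun tvars :: "tm \<Rightarrow> nat set" where
  "tvars (Var n) = {n}"
| "tvars Zero = {}"
| "tvars One = {}"
| "tvars (Add s t) = tvars s \<union> tvars t"

text \<open>Program clauses number their variables from 0; renaming moves them into a reserved block
  of formula variables.\<close>

fun map_vars :: "(nat \<Rightarrow> nat) \<Rightarrow> tm \<Rightarrow> tm" where
  "map_vars r (Var n) = Var (r n)"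
| "map_vars r Zero = Zero"
| "map_vars r One = One"
| "map_vars r (Add s t) = Add (map_vars r s) (map_vars r t)"

fun nval :: "(nat \<Rightarrow> nat) \<Rightarrow> tm \<Rightarrow> nat" where
  "nval \<sigma> (Var n) = \<sigma> n"
| "nval \<sigma> Zero = 0"
| "nval \<sigma> One = 1"
| "nval \<sigma> (Add s t) = nval \<sigma> s + nval \<sigma> t"

lemma tval_num [simp]: "tval v (num n) = int n"
  by (induction n) auto

lemma nval_num [simp]: "nval \<sigma> (num n) = n"
  by (induction n) auto

lemma tvars_num [simp]: "tvars (num n) = {}"
  by (induction n) auto

lemma tval_tmul [simp]: "tval v (tmul n t) = int n * tval v t"
  by (induction n) (auto simp: algebra_simps)

lemma finite_tvars [simp]: "finite (tvars t)"
  by (induction t) auto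

lemma tval_map_vars:
  "(\<And>i. i \<in> tvars t \<Longrightarrow> v (r i) = int (\<sigma> i)) \<Longrightarrow> tval v (map_vars r t) = int (nval \<sigma> t)"
  by (induction t) auto

lemma tval_nval:
  "(\<And>i. i \<in> tvars t \<Longrightarrow> v i = int (\<sigma> i)) \<Longrightarrow> tval v t = int (nval \<sigma> t)"
  by (induction t) auto

definition conjs :: "fm list \<Rightarrow> fm" where
  "conjs fs = foldr Conj fs (Ge Zero Zero)"

definition disjs :: "fm list \<Rightarrow> fm" where
  "disjs fs = foldr Disj fs (Neg (Ge Zero Zero))"

definition eq_fm :: "tm \<Rightarrow> tm \<Rightarrow> fm" where
  "eq_fm s t = Conj (Ge s t) (Ge t s)"

lemma holds_conjs [simp]: "holds v P (conjs fs) \<longleftrightarrow> (\<forall>f\<in>set fs. holds v P f)"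
  unfolding conjs_def by (induction fs) auto

lemma holds_disjs [simp]: "holds v P (disjs fs) \<longleftrightarrow> (\<exists>f\<in>set fs. holds v P f)"
  unfolding disjs_def by (induction fs) auto

lemma qfree_conjs [simp]: "qfree (conjs fs) \<longleftrightarrow> (\<forall>f\<in>set fs. qfree f)"
  unfolding conjs_def by (induction fs) auto

lemma qfree_disjs [simp]: "qfree (disjs fs) \<longleftrightarrow> (\<forall>f\<in>set fs. qfree f)"
  unfolding disjs_def by (induction fs) auto

lemma holds_eq_fm [simp]: "holds v P (eq_fm s t) \<longleftrightarrow> tval v s = tval v t"
  unfolding eq_fm_def by auto

lemma qfree_eq_fm [simp]: "qfree (eq_fm s t)"
  unfolding eq_fm_def by auto

lemma holds_alls:
  "holds v P (alls xs f) \<longleftrightarrow> (\<forall>w. (\<forall>x. x \<notin> set xs \<longrightarrow> w x = v x) \<longrightarrow> holds w P f)"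
proof (induction xs arbitrary: v)
  case Nil
  have "w = v" if "\<forall>x. w x = v x" for w :: "nat \<Rightarrow> int" using that by auto
  then show ?case by (auto simp: alls_def)
next
  case (Cons a xs)
  \<comment> \<open>The value chosen for \<open>a\<close> is recovered as \<open>w a\<close>; this
    also covers a variable \<open>a\<close> that occurs again in \<open>xs\<close>.\<close>
  have "(\<exists>i. \<forall>x. x \<notin> set xs \<longrightarrow> w x = (v(a := i)) x) \<longleftrightarrow> (\<forall>x. x \<notin> set (a # xs) \<longrightarrow> w x = v x)" for w
    by (auto intro: exI[of _ "w a"])
  moreover have "holds v P (alls (a # xs) f) \<longleftrightarrow> (\<forall>i. holds (v(a := i)) P (alls xs f))"
    by (simp add: alls_def)
  ultimately show ?case unfolding Cons.IH by meson
qed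

lemma holds_exs:
  "holds v P (exs xs f) \<longleftrightarrow> (\<exists>w. (\<forall>x. x \<notin> set xs \<longrightarrow> w x = v x) \<and> holds w P f)"
proof (induction xs arbitrary: v)
  case Nil
  have "w = v" if "\<forall>x. w x = v x" for w :: "nat \<Rightarrow> int" using that by auto
  then show ?case by (auto simp: exs_def)
next
  case (Cons a xs)
  have "(\<exists>i. \<forall>x. x \<notin> set xs \<longrightarrow> w x = (v(a := i)) x) \<longleftrightarrow> (\<forall>x. x \<notin> set (a # xs) \<longrightarrow> w x = v x)" for w
    by (auto intro: exI[of _ "w a"])
  moreover have "holds v P (exs (a # xs) f) \<longleftrightarrow> (\<exists>i. holds (v(a := i)) P (exs xs f))"
    by (simp add: exs_def)
  ultimately show ?case unfolding Cons.IH by meson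
qed

section \<open>Horn programs over the natural numbers\<close>

text \<open>A clause consists of its head and the list of its premises; a fact is a list of numbers,
  and the variables of a clause range over the natural numbers.\<close>

type_synonym clause = "tm list \<times> tm list list"

inductive derives :: "clause set \<Rightarrow> nat list \<Rightarrow> bool" for C where
  derivesI: "(h, bs) \<in> C \<Longrightarrow> (\<And>b. b \<in> set bs \<Longrightarrow> derives C (map (nval \<sigma>) b))
    \<Longrightarrow> derives C (map (nval \<sigma>) h)"

definition justified :: "clause set \<Rightarrow> nat list set \<Rightarrow> nat list \<Rightarrow> bool" where
  "justified C S l \<longleftrightarrow> (\<exists>h bs \<sigma>. (h, bs) \<in> C \<and> l = map (nval \<sigma>) h \<and> map (nval \<sigma>) ` set bs \<subseteq> S)"

definition derivation :: "clause set \<Rightarrow> nat list list \<Rightarrow> bool" where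
  "derivation C L \<longleftrightarrow> (\<forall>i<length L. justified C (set (take i L)) (L ! i))"

lemma justified_mono: "justified C S l \<Longrightarrow> S \<subseteq> T \<Longrightarrow> justified C T l"
  unfolding justified_def by blast

lemma derivation_append:
  assumes "derivation C L" "derivation C M"
  shows "derivation C (L @ M)"
  unfolding derivation_def
proof (intro allI impI)
  fix i assume i: "i < length (L @ M)"
  show "justified C (set (take i (L @ M))) ((L @ M) ! i)"
  proof (cases "i < length L")
    case True
    then show ?thesis
      using assms(1) by (simp add: derivation_def nth_append)
  next
    case False
    then have "justified C (set (take (i - length L) M)) (M ! (i - length L))"
      using assms(2) i by (simp add: derivation_def)
    then show ?thesis
      using False by (auto simp: nth_append elim: justified_mono)
  qed
qed

lemma derivation_snoc:
  assumes "derivation C L" "justified C (set L) l"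
  shows "derivation C (L @ [l])"
  using assms by (auto simp: derivation_def nth_append less_Suc_eq)

text \<open>A derivation tree is flattened by concatenating sequences for all premises and appending
  the conclusion.\<close>

lemma derives_derivation:
  assumes "derives C l"
  shows "\<exists>L. derivation C L \<and> l \<in> set L"
  using assms
proof induction
  case (derivesI h bs \<sigma>)
  \<comment> \<open>The premises are collected one at a time; passing to \<open>bs'\<close> inside
    \<open>bs\<close> keeps the hypotheses for the single premises usable.\<close>
  have "\<exists>L. derivation C L \<and> map (nval \<sigma>) ` set bs' \<subseteq> set L" if "set bs' \<subseteq> set bs"
    for bs' :: "tm list list" using that
  proof (induction bs')
    case Nil
    show ?case by (intro exI[of _ "[]"]) (auto simp: derivation_def)
  next
    case (Cons b bs')
    then obtain L where L: "derivation C L" "map (nval \<sigma>) ` set bs' \<subseteq> set L" by auto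
    obtain M where "derivation C M" "map (nval \<sigma>) b \<in> set M"
      using derivesI.IH[of b] Cons.prems by auto
    with L show ?case by (intro exI[of _ "L @ M"]) (auto intro: derivation_append)
  qed
  then obtain L where L: "derivation C L" "map (nval \<sigma>) ` set bs \<subseteq> set L" by blast
  then have "justified C (set L) (map (nval \<sigma>) h)"
    using derivesI.hyps(1) unfolding justified_def by blast
  with L(1) show ?case
    by (intro exI[of _ "L @ [map (nval \<sigma>) h]"]) (simp add: derivation_snoc)
qed

section \<open>Facts as records in a finite set of integers\<close>

text \<open>The residues modulo \<open>2 * K + 2\<close> serve as independent tracks of \<open>P\<close>. A record at position \<open>t\<close>
  marks \<open>t\<close> on the track of the length of the fact, and \<open>t + a\<close> on the track
  \<open>K + 1 + i\<close> if its \<open>i\<close>-th entry is \<open>a\<close>. The bound \<open>N\<close> keeps records at distance more than \<open>N\<close>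
  apart, so that entries of one record cannot be read as entries of another.\<close>

definition rec_at :: "int set \<Rightarrow> nat \<Rightarrow> int \<Rightarrow> int \<Rightarrow> int list \<Rightarrow> bool" where
  "rec_at P K N t l \<longleftrightarrow> int (2 * K + 2) * t + int (length l) \<in> P \<and>
     (\<forall>i<length l. 0 \<le> l ! i \<and> l ! i \<le> N \<and> int (2 * K + 2) * (t + l ! i) + int (K + 1 + i) \<in> P)"

definition rec_fm :: "nat \<Rightarrow> tm \<Rightarrow> tm list \<Rightarrow> fm" where
  "rec_fm K t l = Conj (PAt (Add (tmul (2 * K + 2) t) (num (length l))))
     (conjs (map (\<lambda>i. conjs [Ge (l ! i) Zero, Ge (Var 1) (l ! i),
        PAt (Add (tmul (2 * K + 2) (Add t (l ! i))) (num (K + 1 + i)))]) [0..<length l]))"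

lemma holds_rec_fm [simp]:
  "holds v P (rec_fm K t l) \<longleftrightarrow> rec_at P K (v 1) (tval v t) (map (tval v) l)"
  unfolding rec_fm_def rec_at_def by (auto simp del: tmul.simps num.simps)

lemma qfree_rec_fm [simp]: "qfree (rec_fm K t l)"
  unfolding rec_fm_def by (auto simp del: tmul.simps num.simps)

lemma track_unique:
  fixes a b :: int
  assumes "int M * a + int i = int M * b + int j" "i < M" "j < M"
  shows "a = b \<and> i = j"
proof -
  have "(int M * a + int i) div int M = a" "(int M * b + int j) div int M = b"
    using assms(2,3) by auto
  with assms(1) show ?thesis by auto
qed

text \<open>Fact i sits at position \<open>i * (N + 1)\<close>. Once \<open>N\<close> bounds all
  entries, the entry marks of a fact stay within its own block of \<open>N + 1\<close>
  positions.\<close>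

definition records :: "nat \<Rightarrow> nat \<Rightarrow> nat list list \<Rightarrow> int set" where
  "records K N L = (\<Union>i<length L. insert (int (2 * K + 2) * int (i * (N + 1)) + int (length (L ! i)))
     ((\<lambda>c. int (2 * K + 2) * int (i * (N + 1) + L ! i ! c) + int (K + 1 + c)) ` {..<length (L ! i)}))"

lemma finite_records: "finite (records K N L)"
  unfolding records_def by auto

text \<open>Length marks use tracks up to \<open>K\<close> and entry marks tracks above
  \<open>K\<close>, all below \<open>2 * K + 2\<close>, so the residue of a number in
  \<open>P\<close> tells which kind of mark it is.\<close>

lemma records_base:
  assumes "\<And>l. l \<in> set L \<Longrightarrow> length l \<le> K" "m \<le> K"
    and "int (2 * K + 2) * t + int m \<in> records K N L"
  shows "\<exists>i<length L. t = int (i * (N + 1)) \<and> m = length (L ! i)"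
proof -
  obtain i where i: "i < length L" and
    d: "int (2 * K + 2) * t + int m = int (2 * K + 2) * int (i * (N + 1)) + int (length (L ! i)) \<or>
      (\<exists>c<length (L ! i). int (2 * K + 2) * t + int m =
         int (2 * K + 2) * int (i * (N + 1) + L ! i ! c) + int (K + 1 + c))"
    using assms(3) unfolding records_def by auto
  have len: "length (L ! i) \<le> K" using assms(1) i by simp
  from d show ?thesis
  proof
    assume "int (2 * K + 2) * t + int m = int (2 * K + 2) * int (i * (N + 1)) + int (length (L ! i))"
    from track_unique[OF this] len assms(2) i show ?thesis by auto
  next
    assume "\<exists>c<length (L ! i). int (2 * K + 2) * t + int m =
         int (2 * K + 2) * int (i * (N + 1) + L ! i ! c) + int (K + 1 + c)"
    then obtain c where c: "c < length (L ! i)"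
      "int (2 * K + 2) * t + int m = int (2 * K + 2) * int (i * (N + 1) + L ! i ! c) + int (K + 1 + c)"
      by blast
    from track_unique[OF c(2)] len assms(2) c(1) show ?thesis by auto
  qed
qed

lemma records_entry:
  assumes "\<And>l. l \<in> set L \<Longrightarrow> length l \<le> K" "c < K"
    and "int (2 * K + 2) * t + int (K + 1 + c) \<in> records K N L"
  shows "\<exists>i<length L. c < length (L ! i) \<and> t = int (i * (N + 1) + L ! i ! c)"
proof -
  obtain i where i: "i < length L" and
    d: "int (2 * K + 2) * t + int (K + 1 + c) = int (2 * K + 2) * int (i * (N + 1)) + int (length (L ! i)) \<or>
      (\<exists>c'<length (L ! i). int (2 * K + 2) * t + int (K + 1 + c) =
         int (2 * K + 2) * int (i * (N + 1) + L ! i ! c') + int (K + 1 + c'))"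
    using assms(3) unfolding records_def UN_iff insert_iff image_iff Bex_def lessThan_iff by blast
  have len: "length (L ! i) \<le> K" using assms(1) i by simp
  from d show ?thesis
  proof
    assume "int (2 * K + 2) * t + int (K + 1 + c) =
      int (2 * K + 2) * int (i * (N + 1)) + int (length (L ! i))"
    from track_unique[OF this] len assms(2) show ?thesis by auto
  next
    assume "\<exists>c'<length (L ! i). int (2 * K + 2) * t + int (K + 1 + c) =
         int (2 * K + 2) * int (i * (N + 1) + L ! i ! c') + int (K + 1 + c')"
    then obtain c' where c: "c' < length (L ! i)"
      "int (2 * K + 2) * t + int (K + 1 + c) =
         int (2 * K + 2) * int (i * (N + 1) + L ! i ! c') + int (K + 1 + c')"
      by blast
    have "t = int (i * (N + 1) + L ! i ! c') \<and> K + 1 + c = K + 1 + c'"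
      by (rule track_unique[OF c(2)]) (use len assms(2) c(1) in auto)
    with i c(1) show ?thesis by auto
  qed
qed

lemma block_unique:
  assumes "i * (N + 1) + a = j * (N + 1) + b" "a \<le> N" "b \<le> (N::nat)"
  shows "i = j \<and> a = b"
proof -
  have "(i * (N + 1) + a) div (N + 1) = i" "(j * (N + 1) + b) div (N + 1) = j"
    using assms(2,3) by (simp_all add: div_mult_self3 del: mult_Suc_right)
  with assms(1) show ?thesis by auto
qed

lemma rec_at_records:
  assumes len: "\<And>l. l \<in> set L \<Longrightarrow> length l \<le> K"
    and bound: "\<And>l x. l \<in> set L \<Longrightarrow> x \<in> set l \<Longrightarrow> x \<le> N"
    and l: "length l \<le> K"
  shows "rec_at (records K N L) K (int N) t l \<longleftrightarrow>
    (\<exists>i<length L. t = int (i * (N + 1)) \<and> l = map int (L ! i))"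
proof
  assume r: "rec_at (records K N L) K (int N) t l"
  then obtain i where i: "i < length L" "t = int (i * (N + 1))" "length l = length (L ! i)"
    using records_base[OF len l] unfolding rec_at_def by blast
  have "l ! c = int (L ! i ! c)" if c: "c < length l" for c
  proof -
    have lc: "0 \<le> l ! c" "l ! c \<le> int N"
      "int (2 * K + 2) * (t + l ! c) + int (K + 1 + c) \<in> records K N L"
      using r c unfolding rec_at_def by blast+
    \<comment> \<open>This mark might belong to another record j, but both entries lie between 0 and
      \<open>N\<close>, so the blocks must coincide.\<close>
    obtain j where j: "j < length L" "c < length (L ! j)" "t + l ! c = int (j * (N + 1) + L ! j ! c)"
      using records_entry[OF len _ lc(3)] c l by auto
    have "i * (N + 1) + nat (l ! c) = j * (N + 1) + L ! j ! c"
      using j(3) i(2) lc(1) by linarith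
    moreover have "nat (l ! c) \<le> N" "L ! j ! c \<le> N"
      using lc(2) bound[of "L ! j"] j by auto
    ultimately have "i = j" "nat (l ! c) = L ! j ! c" using block_unique by blast+
    with lc(1) show ?thesis by simp
  qed
  with i show "\<exists>i<length L. t = int (i * (N + 1)) \<and> l = map int (L ! i)"
    by (auto intro!: exI[of _ i] nth_equalityI)
next
  assume "\<exists>i<length L. t = int (i * (N + 1)) \<and> l = map int (L ! i)"
  then obtain i where i: "i < length L" "t = int (i * (N + 1))" "l = map int (L ! i)" by blast
  have sub: "insert (int (2 * K + 2) * int (i * (N + 1)) + int (length (L ! i)))
     ((\<lambda>c. int (2 * K + 2) * int (i * (N + 1) + L ! i ! c) + int (K + 1 + c)) ` {..<length (L ! i)})
     \<subseteq> records K N L"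
    unfolding records_def using i(1) by blast
  have "L ! i ! c \<le> N" if "c < length (L ! i)" for c
    using bound[of "L ! i"] i(1) that by auto
  with sub i show "rec_at (records K N L) K (int N) t l"
    unfolding rec_at_def by (auto simp: subset_iff image_iff simp del: of_nat_mult)
qed

section \<open>Horn programs as formulas\<close>

text \<open>Variables 0, 1, 2 are free: the input, the bound and the position of the goal record. Variable 3
  and the \<open>uvar\<close>s are a universally quantified record, the \<open>wvar\<close>s and \<open>svar\<close>s
  the existentially quantified clause variables and premise positions.\<close>

definition uvar :: "nat \<Rightarrow> nat" where "uvar i = 3 * i + 4"
definition wvar :: "nat \<Rightarrow> nat" where "wvar i = 3 * i + 5"
definition svar :: "nat \<Rightarrow> nat" where "svar i = 3 * i + 6"

lemma var_inject [simp]: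
  "uvar i = uvar j \<longleftrightarrow> i = j" "wvar i = wvar j \<longleftrightarrow> i = j" "svar i = svar j \<longleftrightarrow> i = j"
  by (auto simp: uvar_def wvar_def svar_def)

lemma var_distinct [simp]:
  "uvar i \<noteq> wvar j" "uvar i \<noteq> svar j" "wvar i \<noteq> uvar j" "wvar i \<noteq> svar j"
  "svar i \<noteq> uvar j" "svar i \<noteq> wvar j"
  unfolding uvar_def wvar_def svar_def by presburger+

lemma uvar_gt: "3 < uvar i"
  by (simp add: uvar_def)

lemma var_image [simp]:
  "uvar i \<notin> wvar ` A" "uvar i \<notin> svar ` A" "svar i \<notin> wvar ` A"
  "svar i \<in> svar ` A \<longleftrightarrow> i \<in> A" "wvar i \<in> wvar ` A \<longleftrightarrow> i \<in> A" "uvar i \<in> uvar ` A \<longleftrightarrow> i \<in> A"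
  "n \<le> 3 \<Longrightarrow> n \<notin> uvar ` A" "n \<le> 3 \<Longrightarrow> n \<notin> wvar ` A" "n \<le> 3 \<Longrightarrow> n \<notin> svar ` A"
  by (auto simp: uvar_def wvar_def svar_def) presburger+

text \<open>Quantifiers range over all integers, hence the nonnegativity conditions on clause
  variables. Premises lie at strictly smaller positions, which rules out circular
  justifications.\<close>

definition step_fm :: "nat \<Rightarrow> nat \<Rightarrow> clause \<Rightarrow> fm" where
  "step_fm K V c = conjs (
     map (\<lambda>i. Ge (Var (wvar i)) Zero) [0..<V] @
     map (\<lambda>i. eq_fm (map_vars wvar (fst c ! i)) (Var (uvar i))) [0..<length (fst c)] @
     map (\<lambda>j. Conj (Neg (Ge (Var (svar j)) (Var 3)))
       (rec_fm K (Var (svar j)) (map (map_vars wvar) (snd c ! j)))) [0..<length (snd c)])"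

text \<open>Facts differ in length while the quantified tuple is fixed, so each prefix of length at
  most \<open>K\<close> is tested. A length without clauses yields an empty disjunction, which
  forbids records of that length.\<close>

definition matrix_fm :: "nat \<Rightarrow> nat \<Rightarrow> clause list \<Rightarrow> tm list \<Rightarrow> fm" where
  "matrix_fm K V cs g = Conj (rec_fm K (Var 2) g) (conjs (map (\<lambda>m.
     Disj (Neg (rec_fm K (Var 3) (map (\<lambda>i. Var (uvar i)) [0..<m])))
       (disjs (map (step_fm K V) (filter (\<lambda>c. length (fst c) = m) cs)))) [0..<Suc K]))"

definition horn_fm :: "nat \<Rightarrow> nat \<Rightarrow> nat \<Rightarrow> clause list \<Rightarrow> tm list \<Rightarrow> fm" where
  "horn_fm K V B cs g = alls (3 # map uvar [0..<K])
     (exs (map wvar [0..<V] @ map svar [0..<B]) (matrix_fm K V cs g))"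

lemma horn_fm_AE: "horn_fm K V B cs g \<in> AE_prenex"
proof -
  have "qfree (matrix_fm K V cs g)" by (auto simp: matrix_fm_def step_fm_def)
  then show ?thesis unfolding AE_prenex_def horn_fm_def by blast
qed

lemma holds_step_fm:
  "holds v P (step_fm K V (h, bs)) \<longleftrightarrow> (\<forall>i<V. 0 \<le> v (wvar i)) \<and>
     (\<forall>i<length h. tval v (map_vars wvar (h ! i)) = v (uvar i)) \<and>
     (\<forall>j<length bs. v (svar j) < v 3 \<and>
        rec_at P K (v 1) (v (svar j)) (map (\<lambda>t. tval v (map_vars wvar t)) (bs ! j)))"
  by (simp add: step_fm_def ball_Un comp_def not_le) (simp add: Ball_def)

lemma holds_matrix_fm:
  "holds v P (matrix_fm K V cs g) \<longleftrightarrow> rec_at P K (v 1) (v 2) (map (tval v) g) \<and>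
     (\<forall>m\<le>K. rec_at P K (v 1) (v 3) (map (\<lambda>i. v (uvar i)) [0..<m]) \<longrightarrow>
       (\<exists>c\<in>set cs. length (fst c) = m \<and> holds v P (step_fm K V c)))"
  by (simp add: matrix_fm_def comp_def del: upt_Suc) (simp add: Ball_def Bex_def less_Suc_eq_le)

lemma holds_horn_fm:
  "holds v P (horn_fm K V B cs g) \<longleftrightarrow>
     (\<forall>v'. (\<forall>x. x \<notin> insert 3 (uvar ` {..<K}) \<longrightarrow> v' x = v x) \<longrightarrow>
       (\<exists>w. (\<forall>x. x \<notin> wvar ` {..<V} \<union> svar ` {..<B} \<longrightarrow> w x = v' x) \<and>
         holds w P (matrix_fm K V cs g)))"
  by (simp add: horn_fm_def holds_alls holds_exs atLeast0LessThan)

text \<open>These are the sizes for which the fixed quantifier blocks of \<open>horn_fm\<close>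
  suffice to express the use of the clause.\<close>

definition fits :: "nat \<Rightarrow> nat \<Rightarrow> nat \<Rightarrow> clause \<Rightarrow> bool" where
  "fits K V B c \<longleftrightarrow> length (fst c) \<le> K \<and> length (snd c) \<le> B \<and> (\<forall>b\<in>set (snd c). length b \<le> K) \<and>
     (\<forall>t\<in>set (fst c) \<union> (\<Union>b\<in>set (snd c). set b). tvars t \<subseteq> {..<V})"

lemma fits_mono:
  "fits K V B c \<Longrightarrow> K \<le> K' \<Longrightarrow> V \<le> V' \<Longrightarrow> B \<le> B' \<Longrightarrow> fits K' V' B' c"
  unfolding fits_def subset_iff by fastforce

lemma fits_exists:
  assumes "finite C"
  shows "\<exists>K V B. \<forall>c\<in>C. fits K V B c"
  using assms
proof induction
  case empty
  then show ?case by simp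
next
  case (insert c C)
  then obtain K V B where IH: "\<forall>c\<in>C. fits K V B c" by blast
  define K' where "K' = Max (insert (length (fst c)) (length ` set (snd c)))"
  have "finite (\<Union>t\<in>set (fst c) \<union> (\<Union>b\<in>set (snd c). set b). tvars t)" by simp
  then obtain V' where V': "\<forall>x\<in>(\<Union>t\<in>set (fst c) \<union> (\<Union>b\<in>set (snd c). set b). tvars t). x < V'"
    using finite_nat_set_iff_bounded by blast
  have "fits K' V' (length (snd c)) c"
    using V' unfolding fits_def K'_def by (auto intro: Max_ge)
  with IH have "\<forall>d\<in>insert c C. fits (max K K') (max V V') (max B (length (snd c))) d"
    by (auto intro: fits_mono)
  then show ?case by blast
qed

text \<open>\<open>P\<close> may contain unintended marks. Still, whatever reads as a record of
  natural numbers must have its premises recorded further down, and finiteness of \<open>P\<close>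
  ends the descent.\<close>

lemma rec_at_derives:
  assumes fin: "finite P" and holds: "holds v P (horn_fm K V B cs g)"
    and fits: "\<And>c. c \<in> set cs \<Longrightarrow> fits K V B c"
    and "rec_at P K (v 1) t (map int l)" "length l \<le> K"
  shows "derives (set cs) l"
  using assms(4,5)
\<comment> \<open>Positions may be negative, so the measure is the number of elements of
  \<open>P\<close> below the record.\<close>
proof (induction "card {p \<in> P. p < int (2 * K + 2) * t}" arbitrary: t l rule: less_induct)
  case less
  \<comment> \<open>The universal variables are set to the given record;
    \<open>(x - 4) div 3\<close> inverts \<open>uvar\<close>.\<close>
  define v' where "v' = (\<lambda>x. if x = 3 then t else
    if x \<in> uvar ` {..<length l} then int (l ! ((x - 4) div 3)) else v x)"
  have "\<forall>x. x \<notin> insert 3 (uvar ` {..<K}) \<longrightarrow> v' x = v x"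
    using less.prems(2) by (auto simp: v'_def)
  then obtain w where w: "\<forall>x. x \<notin> wvar ` {..<V} \<union> svar ` {..<B} \<longrightarrow> w x = v' x"
    and hw: "holds w P (matrix_fm K V cs g)"
    using holds unfolding holds_horn_fm by blast
  have w1: "w 1 = v 1" and w3: "w 3 = t"
    using w by (simp_all add: v'_def)
  have wu: "w (uvar i) = int (l ! i)" if "i < length l" for i
    using w that uvar_gt[of i] by (simp add: v'_def) (simp add: uvar_def)
  have "map (\<lambda>i. w (uvar i)) [0..<length l] = map int l"
    by (rule nth_equalityI) (auto simp: wu)
  then have "rec_at P K (w 1) (w 3) (map (\<lambda>i. w (uvar i)) [0..<length l])"
    using less.prems(1) w1 w3 by simp
  then have "\<exists>c\<in>set cs. length (fst c) = length l \<and> holds w P (step_fm K V c)"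
    using hw less.prems(2) unfolding holds_matrix_fm by blast
  then obtain h bs where c: "(h, bs) \<in> set cs" "length h = length l" "holds w P (step_fm K V (h, bs))"
    by (metis prod.collapse)
  note fit = fits[OF c(1), unfolded fits_def fst_conv snd_conv]
  define \<sigma> where "\<sigma> = (\<lambda>i. nat (w (wvar i)))"
  have val: "tval w (map_vars wvar a) = int (nval \<sigma> a)" if "a \<in> set h \<union> (\<Union>b\<in>set bs. set b)" for a
  proof (rule tval_map_vars)
    fix i assume "i \<in> tvars a"
    then have "i < V" using fit that by blast
    then show "w (wvar i) = int (\<sigma> i)" using c(3) by (simp add: holds_step_fm \<sigma>_def)
  qed
  have "map (nval \<sigma>) h = l"
  proof (rule nth_equalityI)
    fix i assume "i < length (map (nval \<sigma>) h)"
    then have i: "i < length h" by simp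
    then have "tval w (map_vars wvar (h ! i)) = w (uvar i)" using c(3) by (simp add: holds_step_fm)
    then show "map (nval \<sigma>) h ! i = l ! i" using i wu val[of "h ! i"] c(2) by simp
  qed (simp add: c(2))
  moreover have "derives (set cs) (map (nval \<sigma>) b)" if b: "b \<in> set bs" for b
  proof -
    obtain j where j: "j < length bs" "bs ! j = b" using b by (auto simp: in_set_conv_nth)
    define s where "s = w (svar j)"
    have st: "s < t" and r: "rec_at P K (v 1) s (map (\<lambda>t. tval w (map_vars wvar t)) b)"
      using c(3) j(1) unfolding holds_step_fm s_def w1[symmetric] w3[symmetric] j(2)[symmetric] by auto
    have "map (\<lambda>t. tval w (map_vars wvar t)) b = map int (map (nval \<sigma>) b)"
      using val b by auto
    with r have r': "rec_at P K (v 1) s (map int (map (nval \<sigma>) b))" by simp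
    have lb: "length b \<le> K" using fit b by blast
    define M where "M = int (2 * K + 2)"
    have p: "M * s + int (length b) \<in> P" using r' by (simp add: rec_at_def M_def)
    have "M * (s + 1) \<le> M * t" using st by (intro mult_left_mono) (auto simp: M_def)
    then have le: "M * s + M \<le> M * t" by (simp add: distrib_left)
    have lM: "int (length b) < M" using lb by (simp add: M_def)
    \<comment> \<open>The length mark of the premise lies in the gap: it is at least
      \<open>M * s\<close>, and below \<open>M * t\<close> because \<open>length b < M\<close> and
      \<open>s + 1 \<le> t\<close>.\<close>
    have "{p \<in> P. p < M * s} \<subset> {p \<in> P. p < M * t}"
    proof
      show "{p \<in> P. p < M * s} \<subseteq> {p \<in> P. p < M * t}" using le lM by fastforce
      have "M * s + int (length b) \<in> {p \<in> P. p < M * t}" using p le lM by simp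
      moreover have "M * s + int (length b) \<notin> {p \<in> P. p < M * s}" by simp
      ultimately show "{p \<in> P. p < M * s} \<noteq> {p \<in> P. p < M * t}" by blast
    qed
    then have "card {p \<in> P. p < int (2 * K + 2) * s} < card {p \<in> P. p < int (2 * K + 2) * t}"
      using fin by (intro psubset_card_mono) (auto simp: M_def)
    from less.hyps[OF this r'] lb show ?thesis by simp
  qed
  ultimately show ?case using derivesI[OF c(1), of \<sigma>] by simp
qed

text \<open>The model lays out a whole derivation of the goal. Premises precede their conclusion in
  the list and therefore have smaller positions.\<close>

lemma derives_holds:
  assumes fits: "\<And>c. c \<in> set cs \<Longrightarrow> fits K V B c"
    and g: "length g \<le> K" "\<And>a. a \<in> set g \<Longrightarrow> tvars a \<subseteq> {0}"
    and der: "derives (set cs) (map (nval (\<lambda>_. n)) g)"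
  shows "\<exists>v P. finite P \<and> v 0 = int n \<and> holds v P (horn_fm K V B cs g)"
proof -
  obtain L where L: "derivation (set cs) L" "map (nval (\<lambda>_. n)) g \<in> set L"
    using derives_derivation[OF der] by blast
  obtain i0 where i0: "i0 < length L" "L ! i0 = map (nval (\<lambda>_. n)) g"
    using L(2) by (auto simp: in_set_conv_nth)
  have len: "length l \<le> K" if l: "l \<in> set L" for l
  proof -
    obtain i where i: "i < length L" "l = L ! i" using l by (metis in_set_conv_nth)
    then obtain h bs \<sigma> where "(h, bs) \<in> set cs" "l = map (nval \<sigma>) h"
      using L(1) unfolding derivation_def justified_def by blast
    then show ?thesis using fits[of "(h, bs)"] by (simp add: fits_def)
  qed
  have "finite (\<Union>l\<in>set L. set l)" by simp
  then obtain N where bound: "l \<in> set L \<Longrightarrow> x \<in> set l \<Longrightarrow> x \<le> N" for l x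
    unfolding finite_nat_set_iff_bounded_le by blast
  let ?P = "records K N L"
  define pos where "pos = (\<lambda>i. int (i * (N + 1)))"
  have pos_eq: "pos i = pos j \<longleftrightarrow> i = j" and pos_less: "pos i < pos j \<longleftrightarrow> i < j" for i j
    unfolding pos_def by (simp_all only: of_nat_eq_iff of_nat_less_iff mult_cancel2 mult_less_cancel2) simp_all
  have rec: "rec_at ?P K (int N) t l \<longleftrightarrow> (\<exists>i<length L. t = pos i \<and> l = map int (L ! i))"
    if "length l \<le> K" for l t
    unfolding pos_def by (rule rec_at_records) (use len bound that in auto)
  define v :: "nat \<Rightarrow> int" where "v = (\<lambda>_. 0)(0 := int n, 1 := int N, 2 := pos i0)"
  have "\<exists>w. (\<forall>x. x \<notin> wvar ` {..<V} \<union> svar ` {..<B} \<longrightarrow> w x = v' x) \<and> holds w ?P (matrix_fm K V cs g)"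
    if v': "\<forall>x. x \<notin> insert 3 (uvar ` {..<K}) \<longrightarrow> v' x = v x" for v'
  proof -
    have v'_012: "v' 0 = int n" "v' 1 = int N" "v' 2 = pos i0"
      using v' by (simp_all add: v_def)
    have goal: "rec_at ?P K (w 1) (w 2) (map (tval w) g)"
      if w: "\<forall>x. x \<notin> wvar ` {..<V} \<union> svar ` {..<B} \<longrightarrow> w x = v' x" for w
    proof -
      have w012: "w 0 = int n" "w 1 = int N" "w 2 = pos i0"
        using w v'_012 by simp_all
      have "map (tval w) g = map int (map (nval (\<lambda>_. n)) g)"
        using g(2) w012 by (auto intro!: tval_nval)
      with w012 show ?thesis using rec[of "map (tval w) g"] g(1) i0 by auto
    qed
    show ?thesis
    proof (cases "\<exists>m\<le>K. rec_at ?P K (int N) (v' 3) (map (\<lambda>i. v' (uvar i)) [0..<m])")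
      \<comment> \<open>No tested prefix of the tuple is a record, so every implication in the
        matrix is vacuous and the existential values are arbitrary.\<close>
      case False
      then show ?thesis
        using goal v'_012 by (intro exI[of _ v']) (auto simp: holds_matrix_fm)
    next
      case True
      then obtain m where "m \<le> K" "rec_at ?P K (int N) (v' 3) (map (\<lambda>i. v' (uvar i)) [0..<m])" by blast
      then obtain i where i: "i < length L" "v' 3 = pos i"
        and u: "map (\<lambda>i. v' (uvar i)) [0..<m] = map int (L ! i)"
        using rec[of "map (\<lambda>i. v' (uvar i)) [0..<m]"] by auto
      have m: "m = length (L ! i)" using arg_cong[OF u, of length] by simp
      have v'_u: "v' (uvar k) = int (L ! i ! k)" if "k < length (L ! i)" for k
        using arg_cong[OF u, of "\<lambda>l. l ! k"] that m by simp
      obtain h bs \<sigma> where c: "(h, bs) \<in> set cs" "L ! i = map (nval \<sigma>) h"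
        "map (nval \<sigma>) ` set bs \<subseteq> set (take i L)"
        using L(1) i(1) unfolding derivation_def justified_def by blast
      note fit = fits[OF c(1), unfolded fits_def fst_conv snd_conv]
      have "\<exists>j<i. L ! j = map (nval \<sigma>) (bs ! k)" if "k < length bs" for k
      proof -
        have "map (nval \<sigma>) (bs ! k) \<in> set (take i L)" using c(3) that by auto
        then show ?thesis using i(1) by (auto simp: in_set_conv_nth)
      qed
      then obtain j where j: "\<And>k. k < length bs \<Longrightarrow> j k < i \<and> L ! j k = map (nval \<sigma>) (bs ! k)"
        by metis
      \<comment> \<open>The witnesses are the clause instance and the positions of its premises;
        \<open>(x - 5) div 3\<close> and \<open>(x - 6) div 3\<close> invert \<open>wvar\<close> and
        \<open>svar\<close>.\<close>
      define w where "w = (\<lambda>x. if x \<in> wvar ` {..<V} then int (\<sigma> ((x - 5) div 3)) else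
        if x \<in> svar ` {..<B} then pos (j ((x - 6) div 3)) else v' x)"
      have w_out: "\<forall>x. x \<notin> wvar ` {..<V} \<union> svar ` {..<B} \<longrightarrow> w x = v' x"
        by (simp add: w_def)
      have w13: "w 1 = int N" "w 3 = pos i" "w (uvar k) = v' (uvar k)" for k
        using w_out v'_012 i(2) by simp_all
      have w_w: "w (wvar k) = int (\<sigma> k)" if "k < V" for k
        using that by (simp add: w_def) (simp add: wvar_def)
      have w_s: "w (svar k) = pos (j k)" if "k < B" for k
        using that by (simp add: w_def) (simp add: svar_def)
      have val: "tval w (map_vars wvar a) = int (nval \<sigma> a)"
        if "a \<in> set h \<union> (\<Union>b\<in>set bs. set b)" for a
        by (rule tval_map_vars) (use fit that w_w in blast)
      have "holds w ?P (step_fm K V (h, bs))"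
        unfolding holds_step_fm
      proof (intro conjI allI impI)
        fix k assume "k < V"
        then show "0 \<le> w (wvar k)" by (simp add: w_w)
      next
        fix k assume "k < length h"
        then show "tval w (map_vars wvar (h ! k)) = w (uvar k)"
          using val[of "h ! k"] v'_u[of k] c(2) by (simp add: w13)
      next
        fix k assume k: "k < length bs"
        then have kB: "k < B" using fit by simp
        show "w (svar k) < w 3"
          using j[OF k] by (simp add: w_s[OF kB] w13 pos_less)
      next
        fix k assume k: "k < length bs"
        then have kB: "k < B" using fit by simp
        have eq: "map (\<lambda>t. tval w (map_vars wvar t)) (bs ! k) = map int (map (nval \<sigma>) (bs ! k))"
          using val nth_mem[OF k] by auto
        have "length (bs ! k) \<le> K" using fit k by auto
        then have "rec_at ?P K (int N) (pos (j k)) (map int (map (nval \<sigma>) (bs ! k)))"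
          by (subst rec) (use j[OF k] i(1) in \<open>auto intro!: exI[of _ "j k"]\<close>)
        then show "rec_at ?P K (w 1) (w (svar k)) (map (\<lambda>t. tval w (map_vars wvar t)) (bs ! k))"
          unfolding eq w13 w_s[OF kB] .
      qed
      \<comment> \<open>The witnesses are chosen before the conjunction over all lengths. One choice
        serves them all since a position carries a record of only one length.\<close>
      moreover have "length h = m"
        if m: "m \<le> K" "rec_at ?P K (w 1) (w 3) (map (\<lambda>i. w (uvar i)) [0..<m])" for m
      proof -
        obtain i' where i': "w 3 = pos i'" "map (\<lambda>i. w (uvar i)) [0..<m] = map int (L ! i')"
          using rec[of "map (\<lambda>i. w (uvar i)) [0..<m]"] m w13(1) by auto
        have "i' = i"
          using i'(1) w13(2) by (simp add: pos_eq)
        with i'(2) have "length (map (\<lambda>i. w (uvar i)) [0..<m]) = length (map int (L ! i))" by simp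
        with c(2) show ?thesis by simp
      qed
      ultimately have "holds w ?P (matrix_fm K V cs g)"
        unfolding holds_matrix_fm using goal[OF w_out] c(1) by (metis fst_conv)
      with w_out show ?thesis by blast
    qed
  qed
  then have "holds v ?P (horn_fm K V B cs g)"
    unfolding holds_horn_fm by blast
  moreover have "v 0 = int n" by (simp add: v_def)
  ultimately show ?thesis using finite_records by blast
qed

text \<open>The two directions are \<open>rec_at_derives\<close> and \<open>derives_holds\<close>.
  The input enters the goal through the free variable 0 alone.\<close>

lemma horn_program_AE:
  assumes "finite C" and g: "\<And>a. a \<in> set g \<Longrightarrow> tvars a \<subseteq> {0}"
  shows "\<exists>f\<in>AE_prenex. \<forall>n. (\<exists>v P. finite P \<and> v 0 = int n \<and> holds v P f) \<longleftrightarrow>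
    derives C (map (nval (\<lambda>_. n)) g)"
proof -
  obtain cs where cs: "set cs = C" using finite_list[OF assms(1)] by blast
  obtain K' V B where KVB: "\<forall>c\<in>C. fits K' V B c" using fits_exists[OF assms(1)] by blast
  define K where "K = max K' (length g)"
  have K: "length g \<le> K" and fits: "\<And>c. c \<in> set cs \<Longrightarrow> fits K V B c"
    using KVB cs by (auto simp: K_def intro: fits_mono)
  have "derives C (map (nval (\<lambda>_. n)) g)"
    if "finite P" "v 0 = int n" "holds v P (horn_fm K V B cs g)" for v P n
  proof -
    note hv = that
    \<comment> \<open>The goal conjunct sits under the quantifiers but mentions only free variables,
      so leaving the universal variables at their values in \<open>v\<close> extracts it.\<close>
    obtain w where w: "\<forall>x. x \<notin> wvar ` {..<V} \<union> svar ` {..<B} \<longrightarrow> w x = v x"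
      and hw: "holds w P (matrix_fm K V cs g)"
      using hv(3) unfolding holds_horn_fm by blast
    have w012: "w 0 = int n" "w 1 = v 1" "w 2 = v 2" using w that(2) by simp_all
    have "map (tval w) g = map int (map (nval (\<lambda>_. n)) g)"
      using g w012 by (auto intro!: tval_nval)
    with hw w012 have "rec_at P K (v 1) (v 2) (map int (map (nval (\<lambda>_. n)) g))"
      by (simp add: holds_matrix_fm)
    from rec_at_derives[OF that(1,3) fits this] K cs show ?thesis by simp
  qed
  moreover have "\<exists>v P. finite P \<and> v 0 = int n \<and> holds v P (horn_fm K V B cs g)"
    if "derives C (map (nval (\<lambda>_. n)) g)" for n
    by (rule derives_holds) (use fits K g that cs in auto)
  ultimately have "(\<exists>v P. finite P \<and> v 0 = int n \<and> holds v P (horn_fm K V B cs g)) \<longleftrightarrow>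
      derives C (map (nval (\<lambda>_. n)) g)" for n
    by blast
  then show ?thesis by (intro bexI[of _ "horn_fm K V B cs g"] allI horn_fm_AE)
qed

section \<open>Recursive functions as Horn programs\<close>

text \<open>Countability supplies the injection \<open>to_nat\<close> by which a program appears as
  a numeral in facts.\<close>

instance recf :: countable by countable_datatype

text \<open>The tag \<open>tag e False\<close> marks the facts \<open>e(xs) = y\<close>, and \<open>tag e True\<close> the facts that
  \<open>e(m, xs)\<close> is positive for all \<open>m < n\<close>, which the minimisation of \<open>e\<close> needs.\<close>

definition tag :: "recf \<Rightarrow> bool \<Rightarrow> nat" where
  "tag e b = to_nat (e, b)"

lemma tag_eq [simp]: "tag e b = tag e' b' \<longleftrightarrow> e = e' \<and> b = b'"
  by (simp add: tag_def)

definition res :: "recf \<Rightarrow> tm \<Rightarrow> tm list \<Rightarrow> tm list" where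
  "res e y xs = num (tag e False) # y # xs"

definition nonzero :: "recf \<Rightarrow> tm \<Rightarrow> tm list \<Rightarrow> tm list" where
  "nonzero e n xs = num (tag e True) # n # xs"

definition vars :: "nat \<Rightarrow> nat \<Rightarrow> tm list" where
  "vars a k = map Var [a..<a + k]"

lemma map_res [simp]: "map (nval \<sigma>) (res e y xs) = tag e False # nval \<sigma> y # map (nval \<sigma>) xs"
  by (simp add: res_def)

lemma map_nonzero [simp]:
  "map (nval \<sigma>) (nonzero e n xs) = tag e True # nval \<sigma> n # map (nval \<sigma>) xs"
  by (simp add: nonzero_def)

lemma length_vars [simp]: "length (vars a k) = k"
  by (simp add: vars_def)

lemma nth_vars [simp]: "i < k \<Longrightarrow> vars a k ! i = Var (a + i)"
  by (simp add: vars_def)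

lemma map_vars_nth: "a + k \<le> length l \<Longrightarrow> map (nval ((!) l)) (vars a k) = take k (drop a l)"
  by (rule nth_equalityI) auto

text \<open>Indexing by arity keeps the program finite: only subprograms at the arities where they
  are called contribute. Variables below the arity are the arguments, later ones intermediate
  values. Calls to which no evaluation rule applies get no clause.\<close>

fun clauses :: "recf \<Rightarrow> nat \<Rightarrow> clause set" where
  "clauses Z k = {(res Z Zero (vars 0 k), [])}"
| "clauses Sc k = (if k = 0 then {} else {(res Sc (Add (Var 0) One) (vars 0 k), [])})"
| "clauses (Pr i) k = (if i < k then {(res (Pr i) (Var i) (vars 0 k), [])} else {})"
| "clauses (Cn f gs) k = insert
     (res (Cn f gs) (Var k) (vars 0 k), res f (Var k) (vars (Suc k) (length gs)) #
        map (\<lambda>i. res (gs ! i) (Var (Suc k + i)) (vars 0 k)) [0..<length gs])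
     (clauses f (length gs) \<union> (\<Union>g\<in>set gs. clauses g k))"
| "clauses (PrimRec f g) 0 = {}"
| "clauses (PrimRec f g) (Suc m) =
     {(res (PrimRec f g) (Var m) (Zero # vars 0 m), [res f (Var m) (vars 0 m)]),
      (res (PrimRec f g) (Var (m + 2)) (Add (Var m) One # vars 0 m),
         [res (PrimRec f g) (Var (m + 1)) (Var m # vars 0 m),
          res g (Var (m + 2)) (Var m # Var (m + 1) # vars 0 m)])} \<union>
     clauses f m \<union> clauses g (Suc (Suc m))"
| "clauses (Mn f) k =
     {(nonzero f Zero (vars 0 k), []),
      (nonzero f (Add (Var k) One) (vars 0 k),
         [nonzero f (Var k) (vars 0 k), res f (Add (Var (k + 1)) One) (Var k # vars 0 k)]),
      (res (Mn f) (Var k) (vars 0 k),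
         [res f Zero (Var k # vars 0 k), nonzero f (Var k) (vars 0 k)])} \<union>
     clauses f (Suc k)"

lemma finite_clauses: "finite (clauses e k)"
  by (induction e k rule: clauses.induct) auto

definition valid :: "nat list \<Rightarrow> bool" where
  "valid l \<longleftrightarrow> (\<forall>e y xs. l = tag e False # y # xs \<longrightarrow> recf_eval e xs y) \<and>
     (\<forall>e n xs. l = tag e True # n # xs \<longrightarrow> (\<forall>m<n. \<exists>k. recf_eval e (m # xs) (Suc k)))"

lemma valid_res [simp]: "valid (tag e False # y # xs) \<longleftrightarrow> recf_eval e xs y"
  by (auto simp: valid_def)

lemma valid_nonzero [simp]:
  "valid (tag e True # n # xs) \<longleftrightarrow> (\<forall>m<n. \<exists>k. recf_eval e (m # xs) (Suc k))"
  by (auto simp: valid_def)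

text \<open>Each clause mirrors an evaluation rule, except that the rule for \<open>Mn\<close> is
  split: the first two clauses extend the range of known positive values step by step, and the third
  adds the zero.\<close>

lemma clauses_valid:
  assumes "(h, bs) \<in> clauses e k" "\<forall>b\<in>set bs. valid (map (nval \<sigma>) b)"
  shows "valid (map (nval \<sigma>) h)"
  using assms
proof (induction e k rule: clauses.induct)
  case (1 k)
  then show ?case by (auto intro: ev_Z)
next
  case (2 k)
  then obtain m where "k = Suc m" by (cases k) auto
  then have "map (nval \<sigma>) (vars 0 k) = \<sigma> 0 # map (nval \<sigma>) (vars 1 m)"
    by (auto intro!: nth_equalityI simp: nth_Cons split: nat.split)
  with 2 \<open>k = Suc m\<close> show ?case by (auto intro: ev_Sc)
next
  case (3 i k)
  have "recf_eval (Pr i) (map (nval \<sigma>) (vars 0 k)) (\<sigma> i)" if "i < k"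
    using ev_Pr[of i "map (nval \<sigma>) (vars 0 k)"] that by simp
  with 3 show ?case by (auto split: if_splits)
next
  case (4 f gs k)
  show ?case
  proof (cases "(h, bs) \<in> clauses f (length gs) \<union> (\<Union>g\<in>set gs. clauses g k)")
    case True
    with 4 show ?thesis by blast
  next
    case False
    then have *: "h = res (Cn f gs) (Var k) (vars 0 k)"
      "bs = res f (Var k) (vars (Suc k) (length gs)) #
        map (\<lambda>i. res (gs ! i) (Var (Suc k + i)) (vars 0 k)) [0..<length gs]"
      using 4(3) by auto
    have "list_all2 (\<lambda>g y. recf_eval g (map (nval \<sigma>) (vars 0 k)) y) gs
        (map (nval \<sigma>) (vars (Suc k) (length gs)))"
      using 4(4) unfolding *(2) by (auto simp: list_all2_conv_all_nth)
    moreover have "recf_eval f (map (nval \<sigma>) (vars (Suc k) (length gs))) (\<sigma> k)"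
      using 4(4) unfolding *(2) by simp
    ultimately show ?thesis unfolding *(1) by (auto intro: ev_Cn)
  qed
next
  case (5 f g)
  then show ?case by simp
next
  case (6 f g m)
  then show ?case by (auto intro: ev_Prim0 ev_PrimS)
next
  case (7 f k)
  then show ?case by (auto simp: less_Suc_eq intro: ev_Mn)
qed

lemma derives_valid:
  assumes "derives (clauses e k) l"
  shows "valid l"
  using assms by induction (use clauses_valid in blast)

lemma derives_by:
  assumes "(h, bs) \<in> C" "\<forall>b\<in>set bs. derives C (map (nval \<sigma>) b)" "l = map (nval \<sigma>) h"
  shows "derives C l"
  using derivesI[of h bs C \<sigma>] assms by simp

text \<open>Allowing any superset \<open>C\<close> lets the hypotheses for subprograms speak about
  the same program.\<close>

lemma recf_eval_derives:
  assumes "recf_eval e xs y" "clauses e (length xs) \<subseteq> C"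
  shows "derives C (tag e False # y # xs)"
  using assms
proof (induction rule: recf_eval.induct)
  case (ev_Z xs)
  then show ?case
    by (intro derives_by[of "res Z Zero (vars 0 (length xs))" "[]" C "(!) xs"])
      (auto simp: map_vars_nth)
next
  case (ev_Sc x xs)
  then show ?case
    by (intro derives_by[of "res Sc (Add (Var 0) One) (vars 0 (length (x # xs)))" "[]" C "(!) (x # xs)"])
      (auto simp: map_vars_nth simp del: length_Cons)
next
  case (ev_Pr i xs)
  then show ?case
    by (intro derives_by[of "res (Pr i) (Var i) (vars 0 (length xs))" "[]" C "(!) xs"])
      (auto simp: map_vars_nth)
next
  case (ev_Cn xs gs ys f z)
  \<comment> \<open>Reading \<open>l\<close> by index matches the variable numbering of the clause:
    arguments, then the value, then the intermediate values.\<close>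
  define l where "l = xs @ [z] @ ys"
  have len: "length ys = length gs" using ev_Cn.IH(1) by (simp add: list_all2_lengthD)
  have xs: "map (nval ((!) l)) (vars 0 (length xs)) = xs"
    and ys: "map (nval ((!) l)) (vars (Suc (length xs)) (length gs)) = ys"
    and z: "l ! length xs = z" by (auto simp: map_vars_nth l_def len)
  have y: "l ! (Suc (length xs + i)) = ys ! i" for i
    by (simp add: l_def nth_append)
  have "derives C (tag f False # z # ys)" using ev_Cn len by auto
  moreover have "derives C (tag (gs ! i) False # ys ! i # xs)" if i: "i < length gs" for i
  proof -
    have "clauses (gs ! i) (length xs) \<subseteq> C" using ev_Cn.prems nth_mem[OF i] by auto
    then show ?thesis using ev_Cn.IH(1) i by (auto simp: list_all2_conv_all_nth)
  qed
  ultimately show ?case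
    by (intro derives_by[of "res (Cn f gs) (Var (length xs)) (vars 0 (length xs))"
          "res f (Var (length xs)) (vars (Suc (length xs)) (length gs)) # map (\<lambda>i. res (gs ! i)
             (Var (Suc (length xs) + i)) (vars 0 (length xs))) [0..<length gs]" C "(!) l"])
      (use ev_Cn.prems in \<open>auto simp: xs ys y z\<close>)
next
  case (ev_Prim0 f xs y g)
  define l where "l = xs @ [y]"
  have "map (nval ((!) l)) (vars 0 (length xs)) = xs" "l ! length xs = y"
    by (auto simp: map_vars_nth l_def)
  with ev_Prim0 show ?case
    by (intro derives_by[of "res (PrimRec f g) (Var (length xs)) (Zero # vars 0 (length xs))"
          "[res f (Var (length xs)) (vars 0 (length xs))]" C "(!) l"]) auto
next
  case (ev_PrimS f g n xs y z)
  define l where "l = xs @ [n, y, z]"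
  have "map (nval ((!) l)) (vars 0 (length xs)) = xs" "l ! length xs = n"
    "l ! Suc (length xs) = y" "l ! Suc (Suc (length xs)) = z"
    by (auto simp: map_vars_nth l_def nth_append)
  with ev_PrimS show ?case
    by (intro derives_by[of
          "res (PrimRec f g) (Var (length xs + 2)) (Add (Var (length xs)) One # vars 0 (length xs))"
          "[res (PrimRec f g) (Var (length xs + 1)) (Var (length xs) # vars 0 (length xs)),
            res g (Var (length xs + 2)) (Var (length xs) # Var (length xs + 1) # vars 0 (length xs))]"
          C "(!) l"]) auto
next
  case (ev_Mn f n xs)
  have sub: "clauses f (Suc (length xs)) \<subseteq> C" using ev_Mn.prems by simp
  \<comment> \<open>Every argument below \<open>n\<close> has a positive value, so the counter of
    the \<open>nonzero\<close> facts can be raised up to \<open>n\<close>.\<close>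
  have nz: "derives C (tag f True # m # xs)" if "m \<le> n" for m
    using that
  proof (induction m)
    case 0
    show ?case
      by (intro derives_by[of "nonzero f Zero (vars 0 (length xs))" "[]" C "(!) xs"])
        (use ev_Mn.prems in \<open>auto simp: map_vars_nth\<close>)
  next
    case (Suc m)
    then obtain k where k: "derives C (tag f False # Suc k # m # xs)"
      using ev_Mn.IH sub by (metis Suc_le_eq length_Cons)
    define l where "l = xs @ [m, k]"
    have "map (nval ((!) l)) (vars 0 (length xs)) = xs" "l ! length xs = m" "l ! Suc (length xs) = k"
      by (auto simp: map_vars_nth l_def nth_append)
    with Suc k ev_Mn.prems show ?case
      by (intro derives_by[of "nonzero f (Add (Var (length xs)) One) (vars 0 (length xs))"
            "[nonzero f (Var (length xs)) (vars 0 (length xs)),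
              res f (Add (Var (length xs + 1)) One) (Var (length xs) # vars 0 (length xs))]" C "(!) l"])
        auto
  qed
  define l where "l = xs @ [n]"
  have "map (nval ((!) l)) (vars 0 (length xs)) = xs" "l ! length xs = n"
    by (auto simp: map_vars_nth l_def)
  with nz[of n] ev_Mn show ?case
    by (intro derives_by[of "res (Mn f) (Var (length xs)) (vars 0 (length xs))"
          "[res f Zero (Var (length xs) # vars 0 (length xs)), nonzero f (Var (length xs)) (vars 0 (length xs))]"
          C "(!) l"]) auto
qed

lemma derives_clauses_iff:
  "derives (clauses e (length xs)) (tag e False # y # xs) \<longleftrightarrow> recf_eval e xs y"
  using derives_valid recf_eval_derives by fastforce

section \<open>Undecidability\<close>

lemma computable_enc_num: "computable 1 (\<lambda>xs. enc_tm (num (xs ! 0)))"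
proof -
  have "computable (Suc 0) (\<lambda>xs. enc_tm (num (xs ! 0)))"
    by (rule computable_prim_rec[of 0 "\<lambda>_. enc_tm Zero"
          "\<lambda>xs. prod_encode (3, prod_encode (xs ! 1, enc_tm One))"])
      (auto intro!: computable_const computable_prod_encode computable_proj simp del: enc_tm.simps(2,3))
  then show ?thesis by simp
qed

definition instantiate :: "nat \<Rightarrow> fm \<Rightarrow> fm" where
  "instantiate n f = Conj (eq_fm (Var 0) (num n)) f"

text \<open>The equation is quantifier-free, hence in \<open>EA_prenex\<close> with both prefixes
  empty.\<close>

lemma instantiate_class: "f \<in> AE_prenex \<Longrightarrow> instantiate n f \<in> EA_AE_class"
  unfolding instantiate_def EA_AE_class_def EA_prenex_def
  by (auto simp: exs_def alls_def intro!: exI[of _ "[]"])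

lemma satisfiable_instantiate:
  "satisfiable (instantiate n f) \<longleftrightarrow> (\<exists>v P. finite P \<and> v 0 = int n \<and> holds v P f)"
  by (auto simp: satisfiable_def instantiate_def)

text \<open>The argument itself serves as the code of the second conjunct, so nothing has to be
  decoded; the outer 3 is the code of \<open>Conj\<close>.\<close>

definition diag :: "nat \<Rightarrow> nat" where
  "diag n = prod_encode (3, prod_encode (enc_fm (eq_fm (Var 0) (num n)), n))"

lemma diag_enc_fm: "diag (enc_fm f) = enc_fm (instantiate (enc_fm f) f)"
  by (simp add: diag_def instantiate_def)

lemma computable_diag: "computable 1 (\<lambda>xs. diag (xs ! 0))"
proof -
  have "(0::nat) < 1" by simp
  note proj = computable_proj[OF this]
  note intros = computable_const computable_prod_encode proj computable_enc_num
  have "computable 1 (\<lambda>xs. prod_encode (3, prod_encode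
      (prod_encode (3, prod_encode
         (prod_encode (0, prod_encode (enc_tm (Var 0), enc_tm (num (xs ! 0)))),
          prod_encode (0, prod_encode (enc_tm (num (xs ! 0)), enc_tm (Var 0))))), xs ! 0)))"
    by (intro intros)
  then show ?thesis by (simp add: diag_def eq_fm_def)
qed

theorem theorem3:
  shows "\<not> sat_decidable EA_AE_class"
proof
  assume "sat_decidable EA_AE_class"
  then obtain f where f: "\<And>\<phi>. \<phi> \<in> EA_AE_class \<Longrightarrow> recf_eval f [enc_fm \<phi>] (if satisfiable \<phi> then 1 else 0)"
    unfolding sat_decidable_def by blast
  obtain r where "\<forall>xs. length xs = 1 \<longrightarrow> recf_eval r xs (diag (xs ! 0))"
    using computable_diag unfolding computable_def by blast
  then have r: "recf_eval r [n] (diag n)" for n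
    by (elim allE[of _ "[n]"]) simp
  \<comment> \<open>On the code of a formula in \<open>AE_prenex\<close>, \<open>h\<close> decides
    whether that formula is satisfiable with variable 0 set to its own code.\<close>
  define h where "h = Cn f [r]"
  have "\<exists>\<theta>\<in>AE_prenex. \<forall>n. (\<exists>v P. finite P \<and> v 0 = int n \<and> holds v P \<theta>) \<longleftrightarrow>
      derives (clauses h 1) (map (nval (\<lambda>_. n)) (res h Zero [Var 0]))"
    by (rule horn_program_AE[OF finite_clauses]) (auto simp: res_def)
  moreover have "derives (clauses h 1) (map (nval (\<lambda>_. n)) (res h Zero [Var 0])) \<longleftrightarrow>
      recf_eval h [n] 0" for n
    using derives_clauses_iff[of h "[n]" 0] by simp
  ultimately obtain \<theta> where \<theta>: "\<theta> \<in> AE_prenex"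
    and sat: "\<And>n. satisfiable (instantiate n \<theta>) \<longleftrightarrow> recf_eval h [n] 0"
    unfolding satisfiable_instantiate by auto
  define n where "n = enc_fm \<theta>"
  have h: "recf_eval h [n] (if satisfiable (instantiate n \<theta>) then 1 else 0)"
    unfolding h_def
  proof (rule ev_Cn[of _ _ "[diag n]"])
    show "list_all2 (\<lambda>g y. recf_eval g [n] y) [r] [diag n]" using r by simp
    show "recf_eval f [diag n] (if satisfiable (instantiate n \<theta>) then 1 else 0)"
      using f[OF instantiate_class[OF \<theta>, of n]] by (simp only: n_def diag_enc_fm)
  qed
  \<comment> \<open>Returning 1 means satisfiable, hence by \<open>sat\<close> also a result 0;
    returning 0 means unsatisfiable, contrary to \<open>sat\<close>.\<close>
  show False
    using recf_eval_deterministic[OF h] h sat[of n] by (auto split: if_splits)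
qed

end
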